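(* Assume that $p>1$ and $a>0$, and consider the nonnegative steady states of the problem $$ \begin{cases} u_t=u^p(u_{xx}+u-\bar u), & t>0,\ 0<x<a,\\ u_x(t,0)=u_x(t,a)=0, & t>0, \end{cases} \qquad \bar u=\frac1a\int_0^a u\,dx . $$ (i) If $a\ne k\pi$ for any $k\in\mathbb N$, then the nonnegative steady states consist of nonnegative constants only. (ii) If $a=k\pi$ for some $k\in\mathbb N$, then the nonnegative steady states consist of the functions $A\cos x+B$ with $0\le|A|\le B$ (that is, the set of nonnegative steady states is exactly the set of all such functions with $A,B\in\mathbb R$).
   Context: Here $\mathbb N=\{1,2,\dots\}$. A nonnegative steady state is a time-independent solution, i.e. a nonnegative function $u^*\in C^2([0,a])$ with $(u^* )^p\left((u^* )''+u^*-\overline{u^*}\right)=0$ in $(0,a)$ and $(u^* )'(0)=(u^* )'(a)=0$, where $\overline{u^*}=\frac1a\int_0^a u^*(x)\,dx$. *)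

theory Defs
  imports "HOL-Analysis.Analysis"
begin

text \<open>
  Functions on the closed interval \<open>[0,a]\<close> are rendered as total functions on the reals of which
  only the values on \<^term>\<open>{0..a}\<close> matter. Accordingly, derivatives are taken within
  \<^term>\<open>{0..a}\<close>, so they are two-sided at interior points and one-sided at \<open>0\<close> and \<open>a\<close>.
\<close>

definition deriv_within :: "real set \<Rightarrow> (real \<Rightarrow> real) \<Rightarrow> real \<Rightarrow> real" where
  "deriv_within S f x = vector_derivative f (at x within S)"

definition C2_on :: "real set \<Rightarrow> (real \<Rightarrow> real) \<Rightarrow> bool" where
  "C2_on S f \<longleftrightarrow>
     f differentiable_on S \<and>
     deriv_within S f differentiable_on S \<and>
     continuous_on S (deriv_within S (deriv_within S f))"

definition spatial_mean :: "real \<Rightarrow> (real \<Rightarrow> real) \<Rightarrow> real" where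
  "spatial_mean a u = (1 / a) * integral {0..a} u"

definition nonneg_steady_state :: "real \<Rightarrow> real \<Rightarrow> (real \<Rightarrow> real) \<Rightarrow> bool" where
  "nonneg_steady_state p a u \<longleftrightarrow>
     C2_on {0..a} u \<and>
     (\<forall>x\<in>{0..a}. 0 \<le> u x) \<and>
     (\<forall>x\<in>{0<..<a}.
        u x powr p * (deriv_within {0..a} (deriv_within {0..a} u) x + u x - spatial_mean a u) = 0) \<and>
     deriv_within {0..a} u 0 = 0 \<and>
     deriv_within {0..a} u a = 0"

end

(*
  Put m for the mean and g = u'' + u - m. Wherever g is nonzero, u vanishes, and so does u'' because
  the set {g \<noteq> 0} is open; hence g only takes the values 0 and -m, and by continuity it is constant
  on (0,a). If it were -m \<noteq> 0, then u would vanish identically, which forces m = 0. So g = 0, and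
  u = A cos x + m by the Neumann condition at 0 and uniqueness for the harmonic oscillator; the
  Neumann condition at a becomes A sin a = 0.
*)
theory Submission
  imports Defs
begin

lemma deriv_within_Icc_eq:
  assumes "(f has_real_derivative d) (at x within {b..c})" "x \<in> {b..c}" "b < c"
  shows "deriv_within {b..c} f x = d"
  using assms unfolding deriv_within_def
  by (auto intro!: vector_derivative_within_closed_interval
      simp: has_real_derivative_iff_has_vector_derivative)

lemma has_real_derivative_deriv_within:
  assumes "f differentiable_on {b..c}" "x \<in> {b..c}" "b < c"
  shows "(f has_real_derivative deriv_within {b..c} f x) (at x within {b..c})"
proof -
  obtain d where "(f has_real_derivative d) (at x within {b..c})"
    using assms real_differentiable_def unfolding differentiable_on_def by blast
  with deriv_within_Icc_eq assms show ?thesis by metis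
qed

text \<open>On an open set the derivative only sees values of \<open>f\<close> inside that set. The
  conclusion has the form of the third hypothesis, so the lemma can be iterated to reach second
  derivatives.\<close>

lemma deriv_within_zero_on_open:
  assumes "open V" "V \<subseteq> {b<..<c}" "\<And>y. y \<in> V \<Longrightarrow> f y = 0" "x \<in> V"
  shows "deriv_within {b..c} f x = 0"
proof (rule deriv_within_Icc_eq)
  have "(f has_real_derivative 0) (at x)"
    by (rule has_field_derivative_transform_within_open[of "\<lambda>_. 0" _ _ V]) (use assms in auto)
  then show "(f has_real_derivative 0) (at x within {b..c})"
    by (rule has_field_derivative_at_within)
qed (use assms in auto)

text \<open>The energy \<open>w^2 + v^2\<close> is conserved along w' = v, v' = -w, and it starts at
  0. Derivatives are asked for in the interior only; continuity carries the conservation to the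
  endpoints.\<close>

lemma oscillator_zero:
  fixes w v :: "real \<Rightarrow> real"
  assumes "0 < a" and "w 0 = 0" "v 0 = 0"
    and cont: "continuous_on {0..a} w" "continuous_on {0..a} v"
    and w: "\<And>x. 0 < x \<Longrightarrow> x < a \<Longrightarrow> (w has_real_derivative v x) (at x)"
    and v: "\<And>x. 0 < x \<Longrightarrow> x < a \<Longrightarrow> (v has_real_derivative - w x) (at x)"
    and "x \<in> {0..a}"
  shows "w x = 0" "v x = 0"
proof -
  have "(w x)\<^sup>2 + (v x)\<^sup>2 = (w 0)\<^sup>2 + (v 0)\<^sup>2"
  proof (rule DERIV_isconst2[OF \<open>0 < a\<close>])
    show "continuous_on {0..a} (\<lambda>x. (w x)\<^sup>2 + (v x)\<^sup>2)"
      by (intro continuous_intros cont)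
    show "((\<lambda>x. (w x)\<^sup>2 + (v x)\<^sup>2) has_real_derivative 0) (at x)" if "0 < x" "x < a" for x
      by (auto intro!: derivative_eq_intros w v that)
  qed (use \<open>x \<in> {0..a}\<close> in auto)
  then show "w x = 0" "v x = 0"
    using assms by auto
qed

lemma spatial_mean_cos:
  assumes "0 < a" "A * sin a = 0" "\<And>x. x \<in> {0..a} \<Longrightarrow> u x = A * cos x + B"
  shows "spatial_mean a u = B"
proof -
  \<comment> \<open>The antiderivative is \<open>A * sin x + B * x\<close>; its sine term vanishes
    at 0, and at \<open>a\<close> by the hypothesis on \<open>A * sin a\<close>.\<close>
  have "((\<lambda>x. A * cos x + B) has_integral (A * sin a + B * a) - (A * sin 0 + B * 0)) {0..a}"
    using \<open>0 < a\<close>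
    by (intro fundamental_theorem_of_calculus)
      (auto intro!: derivative_eq_intros
        simp flip: has_real_derivative_iff_has_vector_derivative)
  then have "(u has_integral B * a) {0..a}"
    using assms by (subst has_integral_cong[where g = "\<lambda>x. A * cos x + B"]) auto
  with \<open>0 < a\<close> show ?thesis
    by (simp add: spatial_mean_def integral_unique)
qed

lemma steady_state_linear_ode:
  assumes "0 < a" and st: "nonneg_steady_state p a u" and "x \<in> {0<..<a}"
  shows "deriv_within {0..a} (deriv_within {0..a} u) x + u x = spatial_mean a u"
proof -
  define D where "D = deriv_within {0..a}"
  define m where "m = spatial_mean a u"
  define g where "g = (\<lambda>x. D (D u) x + u x - m)"
  define V where "V = {x \<in> {0<..<a}. g x \<noteq> 0}"
  have C2: "u differentiable_on {0..a}" "continuous_on {0..a} (D (D u))"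
    and eq: "u x powr p * g x = 0" if "x \<in> {0<..<a}" for x
    using st that by (auto simp: nonneg_steady_state_def C2_on_def D_def g_def m_def)
  have "continuous_on {0..a} g"
    unfolding g_def using C2 differentiable_imp_continuous_on \<open>x \<in> _\<close>
    by (intro continuous_intros) auto
  \<comment> \<open>On the open interval, preimages of open sets under \<open>g\<close> are open in
    the reals, not just relatively open.\<close>
  then have cont: "continuous_on {0<..<a} g"
    by (rule continuous_on_subset) auto
  have "open V"
    using continuous_open_preimage[OF cont, of "- {0}"]
    by (auto simp: V_def vimage_def Int_def)
  \<comment> \<open>A value of \<open>powr\<close> is zero exactly when its base is.\<close>
  have u0: "u y = 0" if "y \<in> V" for y
    using eq[of y] that by (auto simp: V_def)
  have Vsub: "V \<subseteq> {0<..<a}"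
    by (auto simp: V_def)
  \<comment> \<open>The lemma on open sets is applied twice, first to \<open>u\<close> and then to
    \<open>D u\<close>.\<close>
  have DDu0: "D (D u) y = 0" if "y \<in> V" for y
    unfolding D_def by (intro deriv_within_zero_on_open[OF \<open>open V\<close> Vsub] u0 that)
  have g_vals: "g y \<in> {0, -m}" if "y \<in> {0<..<a}" for y
  proof (cases "y \<in> V")
    case True
    then show ?thesis by (simp add: g_def u0 DDu0)
  next
    case False
    with that show ?thesis by (simp add: V_def)
  qed
  \<comment> \<open>A continuous function with finite range on a connected set is constant.\<close>
  have "finite (g ` {0<..<a})"
    using g_vals by (intro finite_subset[OF image_subsetI, of _ g "{0, -m}"]) auto
  then have "g constant_on {0<..<a}"
    by (intro continuous_finite_range_constant[OF _ cont]) auto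
  then obtain c where c: "\<And>y. y \<in> {0<..<a} \<Longrightarrow> g y = c"
    by (auto simp: constant_on_def)
  have "c = 0"
  proof (rule ccontr)
    assume "c \<noteq> 0"
    then have "u y = 0" if "y \<in> {0<..<a}" for y
      using c[OF that] that by (intro u0) (auto simp: V_def)
    \<comment> \<open>The mean is an integral over the closed interval, but \<open>u\<close> is
      known to vanish only inside; the endpoints do not affect the integral.\<close>
    then have "integral {0<..<a} u = integral {0<..<a} (\<lambda>_. 0)"
      by (intro integral_cong)
    then have "m = 0"
      by (simp add: m_def spatial_mean_def integral_open_interval_real)
    with g_vals[OF \<open>x \<in> _\<close>] c[OF \<open>x \<in> _\<close>] \<open>c \<noteq> 0\<close> show False
      by simp
  qed
  with c[OF \<open>x \<in> _\<close>] show ?thesis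
    by (simp add: g_def D_def m_def)
qed

lemma steady_state_imp_cos:
  assumes "0 < a" and st: "nonneg_steady_state p a u"
  obtains A B where "A * sin a = 0" "\<And>x. x \<in> {0..a} \<Longrightarrow> u x = A * cos x + B"
proof -
  define D where "D = deriv_within {0..a}"
  define m where "m = spatial_mean a u"
  \<comment> \<open>The amplitude is forced by the value at 0: it makes \<open>w 0 = 0\<close>
    below.\<close>
  define A where "A = u 0 - m"
  have diff: "u differentiable_on {0..a}" "D u differentiable_on {0..a}"
    and bc: "D u 0 = 0" "D u a = 0"
    using st by (auto simp: nonneg_steady_state_def C2_on_def D_def)
  have D1: "(u has_real_derivative D u x) (at x)"
    and D2: "(D u has_real_derivative m - u x) (at x)" if "0 < x" "x < a" for x
  proof -
    have *: "at x within {0..a} = at x"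
      using that by (intro at_within_Icc_at)
    show "(u has_real_derivative D u x) (at x)"
      using has_real_derivative_deriv_within[of u 0 a x] diff that by (simp add: * D_def)
    have "D (D u) x = m - u x"
      using steady_state_linear_ode[OF assms, of x] that by (simp add: D_def m_def)
    with has_real_derivative_deriv_within[of "D u" 0 a x] diff that
    show "(D u has_real_derivative m - u x) (at x)" by (simp add: * D_def)
  qed
  have cont: "continuous_on {0..a} u" "continuous_on {0..a} (D u)"
    using diff by (auto intro: differentiable_imp_continuous_on)
  \<comment> \<open>These are the deviations of \<open>u\<close> and \<open>D u\<close> from
    \<open>A * cos x + m\<close> and its derivative; they solve the oscillator system with zero
    initial data.\<close>
  define w v where "w = (\<lambda>x. u x - m - A * cos x)" and "v = (\<lambda>x. D u x + A * sin x)"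
  have "continuous_on {0..a} w" "continuous_on {0..a} v"
    unfolding w_def v_def by (intro continuous_intros cont)+
  moreover have "w 0 = 0" "v 0 = 0"
    using bc by (auto simp: w_def v_def A_def)
  moreover have "(w has_real_derivative v x) (at x)" "(v has_real_derivative - w x) (at x)"
    if "0 < x" "x < a" for x
    unfolding w_def v_def by (auto intro!: derivative_eq_intros D1 D2 that)
  ultimately have *: "w x = 0" "v x = 0" if "x \<in> {0..a}" for x
    using oscillator_zero[OF \<open>0 < a\<close>, of w v x] that by blast+
  \<comment> \<open>The condition on \<open>A\<close> is \<open>v a = 0\<close> combined with the
    Neumann condition at \<open>a\<close>.\<close>
  show ?thesis
    using *(1) *(2)[of a] bc \<open>0 < a\<close> by (intro that[of A m]) (auto simp: w_def v_def algebra_simps)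
qed

lemma cos_imp_steady_state:
  assumes "0 < a" "A * sin a = 0"
    and u: "\<And>x. x \<in> {0..a} \<Longrightarrow> u x = A * cos x + B"
    and nn: "\<And>x. x \<in> {0..a} \<Longrightarrow> 0 \<le> A * cos x + B"
  shows "nonneg_steady_state p a u"
proof -
  define D where "D = deriv_within {0..a}"
  \<comment> \<open>Since \<open>u\<close> agrees with the formula on the whole interval, the radius
    1 is an arbitrary choice.\<close>
  have d0: "(u has_real_derivative - A * sin x) (at x within {0..a})" if "x \<in> {0..a}" for x
    by (rule has_field_derivative_transform_within[of "\<lambda>x. A * cos x + B" _ _ _ 1])
      (use that u in \<open>auto intro!: derivative_eq_intros\<close>)
  have D1: "D u x = - A * sin x" if "x \<in> {0..a}" for x
    unfolding D_def using d0 that assms by (intro deriv_within_Icc_eq) auto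
  have d1: "(D u has_real_derivative - A * cos x) (at x within {0..a})" if "x \<in> {0..a}" for x
    by (rule has_field_derivative_transform_within[of "\<lambda>x. - A * sin x" _ _ _ 1])
      (use that D1 in \<open>auto intro!: derivative_eq_intros\<close>)
  have D2: "D (D u) x = - A * cos x" if "x \<in> {0..a}" for x
    using d1 that \<open>0 < a\<close> deriv_within_Icc_eq unfolding D_def by blast
  have "C2_on {0..a} u"
    unfolding C2_on_def D_def[symmetric]
  proof (intro conjI)
    show "u differentiable_on {0..a}" "D u differentiable_on {0..a}"
      using d0 d1 unfolding differentiable_on_def real_differentiable_def by blast+
    have "continuous_on {0..a} (\<lambda>x. - A * cos x)"
      by (intro continuous_intros)
    then show "continuous_on {0..a} (D (D u))"
      by (rule continuous_on_eq) (simp add: D2)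
  qed
  \<comment> \<open>With mean \<open>B\<close> the second factor of the equation is -A cos x + (A
    cos x + B) - B = 0.\<close>
  moreover have "spatial_mean a u = B"
    using assms by (intro spatial_mean_cos) auto
  ultimately show ?thesis
    unfolding nonneg_steady_state_def D_def[symmetric]
    using assms D1 D2 by auto
qed

text \<open>This treats both cases of the theorem at once: they differ only in whether
  \<open>A * sin a = 0\<close> forces \<open>A = 0\<close>.\<close>

lemma nonneg_steady_state_iff:
  assumes "0 < a"
  shows "nonneg_steady_state p a u \<longleftrightarrow>
    (\<exists>A B. A * sin a = 0 \<and> (\<forall>x\<in>{0..a}. u x = A * cos x + B) \<and> (\<forall>x\<in>{0..a}. 0 \<le> A * cos x + B))"
    (is "?L \<longleftrightarrow> ?R")
proof
  assume L: ?L
  then obtain A B where AB: "A * sin a = 0" "\<And>x. x \<in> {0..a} \<Longrightarrow> u x = A * cos x + B"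
    using steady_state_imp_cos[OF assms] by blast
  moreover have "\<forall>x\<in>{0..a}. 0 \<le> u x"
    using L by (simp add: nonneg_steady_state_def)
  ultimately show ?R by (intro exI[of _ A] exI[of _ B]) auto
next
  assume ?R
  then obtain A B where "A * sin a = 0" "\<forall>x\<in>{0..a}. u x = A * cos x + B"
    "\<forall>x\<in>{0..a}. 0 \<le> A * cos x + B"
    by auto
  then show ?L
    by (intro cos_imp_steady_state[OF assms, of A u B]) auto
qed

text \<open>An interval reaching \<open>pi\<close> contains points where cosine is 1 and -1, which
  give -A \<le> B and A \<le> B.\<close>

lemma cos_plus_const_nonneg_iff:
  fixes A B a :: real
  assumes "pi \<le> a"
  shows "(\<forall>x\<in>{0..a}. 0 \<le> A * cos x + B) \<longleftrightarrow> \<bar>A\<bar> \<le> B"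
proof
  assume *: "\<forall>x\<in>{0..a}. 0 \<le> A * cos x + B"
  show "\<bar>A\<bar> \<le> B"
    using *[THEN bspec, of 0] *[THEN bspec, of pi] assms pi_ge_zero by (auto simp: abs_if)
next
  assume *: "\<bar>A\<bar> \<le> B"
  have "\<bar>A * cos x\<bar> \<le> \<bar>A\<bar>" for x
    by (simp add: abs_mult mult_left_le)
  with * show "\<forall>x\<in>{0..a}. 0 \<le> A * cos x + B"
    by (smt (verit))
qed

theorem proposition4p1:
  fixes p a :: real
  assumes "p > 1" and "a > 0"
  shows "((\<forall>k::nat. k \<ge> 1 \<longrightarrow> a \<noteq> real k * pi) \<longrightarrow>
            (\<forall>u :: real \<Rightarrow> real. nonneg_steady_state p a u \<longleftrightarrow>
               (\<exists>c::real. 0 \<le> c \<and> (\<forall>x\<in>{0..a}. u x = c)))) \<and>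
         ((\<exists>k::nat. k \<ge> 1 \<and> a = real k * pi) \<longrightarrow>
            (\<forall>u :: real \<Rightarrow> real. nonneg_steady_state p a u \<longleftrightarrow>
               (\<exists>A B :: real. 0 \<le> \<bar>A\<bar> \<and> \<bar>A\<bar> \<le> B \<and> (\<forall>x\<in>{0..a}. u x = A * cos x + B))))"
proof (intro conjI impI allI)
  fix u :: "real \<Rightarrow> real"
  assume a: "\<forall>k::nat. k \<ge> 1 \<longrightarrow> a \<noteq> real k * pi"
  have "sin a \<noteq> 0"
  proof
    assume "sin a = 0"
    then obtain i :: int where i: "a = of_int i * pi"
      by (auto simp: sin_zero_iff_int2)
    with \<open>a > 0\<close> have "i > 0"
      by (simp add: zero_less_mult_iff)
    \<comment> \<open>The multiple \<open>i\<close> is a positive integer, so \<open>nat i\<close>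
      is a natural number at least 1, which \<open>a\<close> excludes.\<close>
    with i a[rule_format, of "nat i"] show False by (simp add: Suc_le_eq)
  qed
  then show "nonneg_steady_state p a u \<longleftrightarrow> (\<exists>c::real. 0 \<le> c \<and> (\<forall>x\<in>{0..a}. u x = c))"
    using \<open>a > 0\<close> by (auto simp: nonneg_steady_state_iff)
next
  fix u :: "real \<Rightarrow> real"
  assume "\<exists>k::nat. k \<ge> 1 \<and> a = real k * pi"
  then obtain k :: nat where k: "k \<ge> 1" "a = real k * pi" by blast
  \<comment> \<open>The first fact removes the constraint on \<open>A\<close>; the second, from k
    \<ge> 1, makes the nonnegativity criterion available.\<close>
  then have "sin a = 0" "pi \<le> a"
    by auto
  then show "nonneg_steady_state p a u \<longleftrightarrow>
      (\<exists>A B :: real. 0 \<le> \<bar>A\<bar> \<and> \<bar>A\<bar> \<le> B \<and> (\<forall>x\<in>{0..a}. u x = A * cos x + B))"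
    using nonneg_steady_state_iff[OF \<open>a > 0\<close>, of p u]
    by (auto simp: cos_plus_const_nonneg_iff)
qed

end
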